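(* Let $\mathbb{F}$ be a subfield of $\mathbb{R}$, let $X$ be a real linear space, let $D\subseteq X$ be a nonempty $\mathbb{F}$-algebraically open convex set, and let $\alpha:D^*\to[0,\infty)$ be an even function, where $D^*=D-D$. For any function $f:D\to\mathbb{R}$, the following conditions are equivalent: (i) $f$ is strongly $(\alpha,\mathbb{F})$-convex. (ii) $f$ is $\mathbb{F}$-directionally differentiable at every point of $D$, for all $x_0\in D$ the map $h\mapsto f'_{\mathbb{F}}(x_0,h)$ is $\mathbb{F}$-sublinear on $X$, and furthermore, for all $x_0,x\in D$, $$f(x)\geq f(x_0)+f'_{\mathbb{F}}(x_0,x-x_0)+\alpha(x-x_0).$$ (iii) For all $x_0\in D$ there exists an element $\varphi\in X'_{\mathbb{F}}$ such that $$f(x)\geq f(x_0)+\varphi(x-x_0)+\alpha(x-x_0)\quad\text{for all } x\in D.$$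
   Context: Notation: $D^*:=D-D=\{x-y: x,y\in D\}$. "Convex set" has its usual (real) meaning. A nonempty set $D\subseteq X$ is $\mathbb{F}$-algebraically open if for all $x_0\in D$ and $h\in X$ there exists $\varepsilon>0$ such that the segment $[x_0,x_0+th]$ is contained in $D$ for all $t\in[0,\varepsilon]\cap\mathbb{F}$. A function $f:D\to\mathbb{R}$ is strongly $(\alpha,\mathbb{F})$-convex if for all $x,y\in D$ and $t\in\mathbb{F}\cap[0,1]$, $$f(tx+(1-t)y)\leq tf(x)+(1-t)f(y)-t\,\alpha\big((1-t)(x-y)\big)-(1-t)\,\alpha\big(t(y-x)\big).$$ $f$ is $\mathbb{F}$-directionally differentiable at $x_0\in D$ if for every $h\in X$ the limit $$f'_{\mathbb{F}}(x_0,h):=\lim_{t\to0^+,\ t\in\mathbb{F}}\frac{f(x_0+th)-f(x_0)}{t}$$ exists as a (finite) real number. A function $\psi:X\to\mathbb{R}$ is $\mathbb{F}$-sublinear if $\psi(x+y)\leq\psi(x)+\psi(y)$ for all $x,y\in X$ and $\psi(\lambda x)=\lambda\psi(x)$ for all $x\in X$, $\lambda\in\mathbb{F}\cap[0,\infty)$. $X'_{\mathbb{F}}$ is the set of all $\mathbb{F}$-linear functions $\varphi:X\to\mathbb{R}$, i.e. those that are additive and satisfy $\varphi(\lambda x)=\lambda\varphi(x)$ for all $x\in X$, $\lambda\in\mathbb{F}$. *)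

theory Defs
  imports "HOL-Analysis.Analysis" "HOL-Algebra.Algebraic_Closure_Type"
begin

abbreviation real_subfield :: "real set \<Rightarrow> bool"
  where "real_subfield F \<equiv> subfield F (ring_of_type_algebra :: real ring)"

lemma real_subfield_iff:
  "real_subfield F \<longleftrightarrow>
     1 \<in> F \<and> (\<forall>a\<in>F. \<forall>b\<in>F. a - b \<in> F \<and> a * b \<in> F) \<and> (\<forall>a\<in>F. a \<noteq> 0 \<longrightarrow> inverse a \<in> F)"
proof -
  let ?R = "ring_of_type_algebra :: real ring"
  interpret field ?R by (rule field_from_type_algebra)
  have mul: "a \<otimes>\<^bsub>?R\<^esub> b = a * b" and one: "\<one>\<^bsub>?R\<^esub> = 1" and zero: "\<zero>\<^bsub>?R\<^esub> = 0"
    and add: "a \<oplus>\<^bsub>?R\<^esub> b = a + b" and car: "carrier ?R = UNIV" for a b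
    by (simp_all add: ring_of_type_algebra_def)
  have neg: "\<ominus>\<^bsub>?R\<^esub> a = - a" for a
    by (rule minus_equality) (simp_all add: add zero car)
  have inv: "inv\<^bsub>?R\<^esub> a = inverse a" if "a \<noteq> 0" for a
    by (rule comm_inv_char) (use that in \<open>simp_all add: mul one car\<close>)
  show ?thesis (is "_ \<longleftrightarrow> ?P")
  proof
    assume K: "real_subfield F"
    note S = subfieldE(1)[OF K]
    have "a - b \<in> F" if "a \<in> F" "b \<in> F" for a b
      using subringE(7)[OF S that(1) subringE(5)[OF S that(2)]] by (simp add: add neg)
    moreover have "inverse a \<in> F" if "a \<in> F" "a \<noteq> 0" for a
      using subfield_m_inv(1)[OF K, of a] that by (simp add: zero inv)
    ultimately show ?P
      using subringE(3)[OF S] subringE(6)[OF S] by (simp add: one mul)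
  next
    assume P: ?P
    have z: "0 \<in> F" using P by force
    have n: "- a \<in> F" if "a \<in> F" for a using P z that by (metis diff_0)
    have p: "a + b \<in> F" if "a \<in> F" "b \<in> F" for a b
      using P n[OF that(2)] that by (metis diff_minus_eq_add)
    have "subring F ?R"
      by (rule subringI) (use P n p in \<open>auto simp: one mul add neg car\<close>)
    then show "real_subfield F"
      by (rule subfieldI') (use P in \<open>auto simp: zero inv\<close>)
  qed
qed

definition diff_set :: "'a::ab_group_add set \<Rightarrow> 'a set"
  where "diff_set D = {x - y | x y. x \<in> D \<and> y \<in> D}"

definition algebraically_open :: "real set \<Rightarrow> 'a::real_vector set \<Rightarrow> bool"
  where "algebraically_open F D \<longleftrightarrow>
    D \<noteq> {} \<and>
    (\<forall>x0\<in>D. \<forall>h. \<exists>\<epsilon>>0. \<forall>t\<in>{0..\<epsilon>} \<inter> F. closed_segment x0 (x0 + t *\<^sub>R h) \<subseteq> D)"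

text \<open>
  A function on \<open>D\<close> or on \<open>diff_set D\<close> is represented by a total function; none of the notions
  below depends on its values outside that domain (for convex \<open>D\<close> in the case of strong
  convexity, for algebraically open \<open>D\<close> in the case of directional derivatives).
\<close>

definition strongly_convex ::
    "('a::real_vector \<Rightarrow> real) \<Rightarrow> real set \<Rightarrow> 'a set \<Rightarrow> ('a \<Rightarrow> real) \<Rightarrow> bool"
  where "strongly_convex \<alpha> F D f \<longleftrightarrow>
    (\<forall>x\<in>D. \<forall>y\<in>D. \<forall>t\<in>F \<inter> {0..1}.
      f (t *\<^sub>R x + (1 - t) *\<^sub>R y) \<le>
        t * f x + (1 - t) * f y
        - t * \<alpha> ((1 - t) *\<^sub>R (x - y)) - (1 - t) * \<alpha> (t *\<^sub>R (y - x)))"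

definition dir_differentiable ::
    "real set \<Rightarrow> ('a::real_vector \<Rightarrow> real) \<Rightarrow> 'a \<Rightarrow> bool"
  where "dir_differentiable F f x0 \<longleftrightarrow>
    (\<forall>h. \<exists>l. ((\<lambda>t. (f (x0 + t *\<^sub>R h) - f x0) / t) \<longlongrightarrow> l) (at 0 within F \<inter> {0<..}))"

text \<open>
  The value is meaningful only if the limit exists; it is then unique, since 0 is a limit point
  of the positive elements of a subfield.
\<close>

definition dir_deriv ::
    "real set \<Rightarrow> ('a::real_vector \<Rightarrow> real) \<Rightarrow> 'a \<Rightarrow> 'a \<Rightarrow> real"
  where "dir_deriv F f x0 h =
    Lim (at 0 within F \<inter> {0<..}) (\<lambda>t. (f (x0 + t *\<^sub>R h) - f x0) / t)"

definition F_sublinear :: "real set \<Rightarrow> ('a::real_vector \<Rightarrow> real) \<Rightarrow> bool"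
  where "F_sublinear F \<psi> \<longleftrightarrow>
    (\<forall>x y. \<psi> (x + y) \<le> \<psi> x + \<psi> y) \<and>
    (\<forall>x. \<forall>c\<in>F \<inter> {0..}. \<psi> (c *\<^sub>R x) = c * \<psi> x)"

definition F_dual :: "real set \<Rightarrow> ('a::real_vector \<Rightarrow> real) set"
  where "F_dual F =
    {\<phi>. (\<forall>x y. \<phi> (x + y) = \<phi> x + \<phi> y) \<and> (\<forall>x. \<forall>c\<in>F. \<phi> (c *\<^sub>R x) = c * \<phi> x)}"

end

theory Submission
  imports Defs
begin

text \<open>
  Convexity makes the difference quotients at a point monotone and bounded below, so directional
  derivatives exist and are sublinear. Since \<open>\<alpha>\<close> has no continuity property, the term
  \<open>\<alpha> (x - x0)\<close> in (ii) cannot be obtained by letting \<open>t \<rightarrow> 0\<close> in the inequality between \<open>x0\<close> and \<open>x\<close>.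
  Instead one applies strong convexity between \<open>x0\<close> and \<open>x0 + (1 + s) (x - x0)\<close> with parameter
  \<open>s / (1 + s)\<close>, where the argument of the first \<open>\<alpha>\<close> is exactly \<open>x - x0\<close>, and lets \<open>s \<rightarrow> 0\<close>, using
  continuity of \<open>f\<close> at \<open>x\<close> along \<open>F\<close>-rays. From (ii) to (iii) is the Hahn-Banach theorem
  over \<open>F\<close>, and (iii) implies (i) by averaging the support inequalities at \<open>t x + (1 - t) y\<close>.
\<close>

section \<open>Subfields of the reals\<close>

lemma real_subfield_closed:
  assumes "real_subfield F"
  shows "0 \<in> F" "1 \<in> F"
    and "a \<in> F \<Longrightarrow> b \<in> F \<Longrightarrow> a + b \<in> F"
    and "a \<in> F \<Longrightarrow> b \<in> F \<Longrightarrow> a - b \<in> F"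
    and "a \<in> F \<Longrightarrow> b \<in> F \<Longrightarrow> a * b \<in> F"
    and "a \<in> F \<Longrightarrow> b \<in> F \<Longrightarrow> a / b \<in> F"
proof -
  note P = assms[unfolded real_subfield_iff]
  show z: "0 \<in> F" and "1 \<in> F" using P by force+
  have n: "- b \<in> F" if "b \<in> F" for b using P z that by (metis diff_0)
  show "a + b \<in> F" if "a \<in> F" "b \<in> F" using P n[OF that(2)] that by (metis diff_minus_eq_add)
  show "a - b \<in> F" "a * b \<in> F" if "a \<in> F" "b \<in> F" using P that by auto
  \<comment> \<open>For \<open>b = 0\<close> the convention that division by zero yields 0 keeps the
    quotient in \<open>F\<close>.\<close>
  show "a / b \<in> F" if "a \<in> F" "b \<in> F"
    using P z that by (cases "b = 0") (auto simp: divide_inverse)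
qed

text \<open>A subfield contains all natural numbers, hence all \<open>1 / real (Suc n)\<close>, and
  these become arbitrarily small.\<close>

lemma real_subfield_small_pos:
  assumes F: "real_subfield F" and "0 < e"
  obtains d where "d \<in> F" "0 < d" "d < e"
proof -
  obtain n where n: "inverse (real (Suc n)) < e" using reals_Archimedean[OF \<open>0 < e\<close>] by blast
  have "real n \<in> F" for n
    by (induction n) (auto simp: real_subfield_closed[OF F])
  then have "1 / real (Suc n) \<in> F" by (intro real_subfield_closed[OF F])
  with n that show ?thesis by (simp add: inverse_eq_divide)
qed

lemma eventually_at_0_within_pos:
  fixes F :: "real set"
  assumes "0 < d" and "\<And>t. t \<in> F \<Longrightarrow> 0 < t \<Longrightarrow> t < d \<Longrightarrow> P t"
  shows "eventually P (at 0 within F \<inter> {0<..})"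
  unfolding eventually_at by (rule exI[of _ d]) (use assms in auto)

text \<open>This makes limits along \<open>F\<close> unique and lets non-strict inequalities pass to
  the limit.\<close>

lemma at_0_within_pos_neq_bot:
  assumes "real_subfield F"
  shows "at (0::real) within F \<inter> {0<..} \<noteq> bot"
proof -
  have "\<exists>y\<in>F \<inter> {0<..}. y \<noteq> 0 \<and> dist y 0 < e" if "e > 0" for e :: real
    using real_subfield_small_pos[OF assms that] by (force simp: dist_real_def)
  then show ?thesis by (auto simp: trivial_limit_within islimpt_approachable)
qed

text \<open>Permits the substitution of \<open>c * t\<close> for \<open>t\<close> that yields
  positive homogeneity of directional derivatives.\<close>

lemma filterlim_mult_at_0_within_pos:
  assumes F: "real_subfield F" and c: "c \<in> F" "0 < c"
  shows "filterlim ((*) c) (at 0 within F \<inter> {0<..}) (at 0 within F \<inter> {0<..})"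
  unfolding filterlim_at
proof
  show "\<forall>\<^sub>F x in at 0 within F \<inter> {0<..}. c * x \<in> F \<inter> {0<..} \<and> c * x \<noteq> 0"
    by (rule eventually_at_0_within_pos[of 1]) (use c in \<open>auto simp: real_subfield_closed[OF F]\<close>)
  show "((*) c \<longlongrightarrow> 0) (at 0 within F \<inter> {0<..})"
    by (auto intro!: tendsto_eq_intros)
qed

text \<open>The limit is the infimum of \<open>q\<close> over the elements of \<open>F\<close>
  between 0 and \<open>d\<close>: once some \<open>q t\<close> is close to it, monotonicity keeps
  \<open>q s\<close> at least as close for all smaller \<open>s\<close>.\<close>

lemma mono_bounded_tendsto_at_0_within_pos:
  fixes q :: "real \<Rightarrow> real"
  assumes F: "real_subfield F" and d: "d > 0"
    and mono: "\<And>s t. s \<in> F \<Longrightarrow> t \<in> F \<Longrightarrow> 0 < s \<Longrightarrow> s < t \<Longrightarrow> t < d \<Longrightarrow> q s \<le> q t"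
    and lower: "\<And>t. t \<in> F \<Longrightarrow> 0 < t \<Longrightarrow> t < d \<Longrightarrow> m \<le> q t"
  obtains l where "(q \<longlongrightarrow> l) (at 0 within F \<inter> {0<..})"
proof
  let ?A = "F \<inter> {0<..<d}"
  let ?l = "INF t\<in>?A. q t"
  obtain t0 where "t0 \<in> F" "0 < t0" "t0 < d" using real_subfield_small_pos[OF F d] by blast
  then have ne: "?A \<noteq> {}" by auto
  have bdd: "bdd_below (q ` ?A)" using lower by (intro bdd_belowI2[of _ m]) auto
  show "(q \<longlongrightarrow> ?l) (at 0 within F \<inter> {0<..})"
  proof (rule order_tendstoI)
    fix a assume "a < ?l"
    show "\<forall>\<^sub>F t in at 0 within F \<inter> {0<..}. a < q t"
    proof (rule eventually_at_0_within_pos[OF d])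
      fix t assume "t \<in> F" "0 < t" "t < d"
      then have "?l \<le> q t" by (intro cINF_lower bdd) auto
      with \<open>a < ?l\<close> show "a < q t" by simp
    qed
  next
    fix a assume "?l < a"
    then obtain t where t: "t \<in> ?A" "q t < a" using cINF_less_iff[OF ne bdd] by blast
    show "\<forall>\<^sub>F s in at 0 within F \<inter> {0<..}. q s < a"
      by (rule eventually_at_0_within_pos[of t]) (use t mono in force)+
  qed
qed

section \<open>The Hahn-Banach theorem over a subfield of the reals\<close>

lemma F_sublinear_add: "F_sublinear F p \<Longrightarrow> p (x + y) \<le> p x + p y"
  by (simp add: F_sublinear_def)

lemma F_sublinear_scale: "F_sublinear F p \<Longrightarrow> c \<in> F \<Longrightarrow> 0 \<le> c \<Longrightarrow> p (c *\<^sub>R x) = c * p x"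
  by (simp add: F_sublinear_def)

lemma F_sublinear_zero: "real_subfield F \<Longrightarrow> F_sublinear F p \<Longrightarrow> p 0 = 0"
  using F_sublinear_scale[of F p 0 0] by (simp add: real_subfield_closed)

lemma F_sublinear_minus:
  assumes "real_subfield F" "F_sublinear F p"
  shows "- p (- x) \<le> p x"
  using F_sublinear_add[OF assms(2), of x "- x"] F_sublinear_zero[OF assms] by simp

text \<open>One inequality for positive scalars suffices: applied to \<open>1 / c\<close> at the
  point \<open>c *\<^sub>R x\<close> it gives the reverse one.\<close>

lemma F_sublinearI:
  assumes F: "real_subfield F"
    and add: "\<And>x y. p (x + y) \<le> p x + p y" and zero: "p 0 = 0"
    and scale: "\<And>c x. c \<in> F \<Longrightarrow> 0 < c \<Longrightarrow> p (c *\<^sub>R x) \<le> c * p x"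
  shows "F_sublinear F p"
  unfolding F_sublinear_def
proof (intro conjI allI ballI)
  fix x c assume c: "c \<in> F \<inter> {0..}"
  show "p (c *\<^sub>R x) = c * p x"
  proof (cases "c = 0")
    case False
    with c have pos: "c \<in> F" "0 < c" by auto
    then have "1 / c \<in> F" by (intro real_subfield_closed[OF F])
    from scale[OF this, of "c *\<^sub>R x"] pos have "p x \<le> p (c *\<^sub>R x) / c" by simp
    with pos have "c * p x \<le> p (c *\<^sub>R x)" by (simp add: field_simps)
    with scale[OF pos] show ?thesis by (simp add: antisym)
  qed (simp add: zero)
qed (rule add)

text \<open>Supplies the lower bounds of chains for Zorn's lemma. The pointwise infima are finite
  because every member is bounded below by \<open>- \<psi> (- x)\<close>.\<close>

lemma F_sublinear_chain_INF:
  assumes F: "real_subfield F" and ne: "C \<noteq> {}"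
    and sub: "\<And>p. p \<in> C \<Longrightarrow> F_sublinear F p \<and> p \<le> \<psi>"
    and chain: "\<And>p q. p \<in> C \<Longrightarrow> q \<in> C \<Longrightarrow> p \<le> q \<or> q \<le> p"
  shows "F_sublinear F (\<lambda>x. INF p\<in>C. p x)" and "p \<in> C \<Longrightarrow> (INF p\<in>C. p x) \<le> p x"
proof -
  have "- \<psi> (- x) \<le> p x" if "p \<in> C" for p x
    using F_sublinear_minus[OF F, of p x] sub[OF that] le_funD[of p \<psi> "- x"] by linarith
  then have bdd: "bdd_below ((\<lambda>p. p x) ` C)" for x by (intro bdd_belowI2) auto
  let ?u = "\<lambda>x. INF p\<in>C. p x"
  have low: "?u x \<le> p x" if "p \<in> C" for p x
    using cINF_lower[OF bdd that] .
  then show "p \<in> C \<Longrightarrow> ?u x \<le> p x" .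
  show "F_sublinear F ?u"
  proof (rule F_sublinearI[OF F])
    fix x y
    \<comment> \<open>Splitting into two infima needs \<open>p\<close> and \<open>q\<close> to vary
      independently; in a chain the smaller of the two is one subadditive function that lies below
      both.\<close>
    have *: "?u (x + y) \<le> p x + q y" if pq: "p \<in> C" "q \<in> C" for p q
    proof -
      obtain m where m: "m \<in> C" "m \<le> p" "m \<le> q" using chain[OF pq] pq by blast
      have "?u (x + y) \<le> m (x + y)" by (rule low[OF m(1)])
      also have "\<dots> \<le> m x + m y" using sub[OF m(1)] F_sublinear_add by blast
      also have "\<dots> \<le> p x + q y" using m by (intro add_mono) (auto simp: le_fun_def)
      finally show ?thesis .
    qed
    have "?u (x + y) - p x \<le> ?u y" if "p \<in> C" for p
      by (rule cINF_greatest[OF ne]) (use *[OF that] in \<open>simp add: algebra_simps\<close>)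
    then have "?u (x + y) - ?u y \<le> p x" if "p \<in> C" for p
      using that by (simp add: algebra_simps)
    then have "?u (x + y) - ?u y \<le> ?u x" by (rule cINF_greatest[OF ne])
    then show "?u (x + y) \<le> ?u x + ?u y" by simp
  next
    have "(\<lambda>p. p 0) ` C = {0}" using ne sub F_sublinear_zero[OF F] by force
    then show "?u 0 = 0" by simp
  next
    fix c x assume c: "c \<in> F" "0 < c"
    have "?u (c *\<^sub>R x) / c \<le> p x" if "p \<in> C" for p
      using low[OF that, of "c *\<^sub>R x"] F_sublinear_scale[of F p c x] sub[OF that] c
      by (simp add: field_simps)
    then have "?u (c *\<^sub>R x) / c \<le> ?u x" by (rule cINF_greatest[OF ne])
    then show "?u (c *\<^sub>R x) \<le> c * ?u x" using c by (simp add: field_simps)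
  qed
qed

text \<open>The device that exploits minimality of \<open>p\<close>. Taking \<open>c = 0\<close>
  shows that \<open>q\<close> lies below \<open>p\<close>, and \<open>c = 1\<close> gives
  \<open>q x + p y \<le> p (x + y)\<close>, so \<open>q = p\<close> forces superadditivity.\<close>

lemma F_sublinear_shift:
  fixes y :: "'a::real_vector"
  assumes F: "real_subfield F" and p: "F_sublinear F p"
  defines "q \<equiv> \<lambda>x. INF c\<in>F \<inter> {0..}. p (x + c *\<^sub>R y) - c * p y"
  shows "F_sublinear F q" and "c \<in> F \<Longrightarrow> 0 \<le> c \<Longrightarrow> q x \<le> p (x + c *\<^sub>R y) - c * p y"
proof -
  have ne: "F \<inter> {0..} \<noteq> {}" using real_subfield_closed(1)[OF F] by auto
  \<comment> \<open>The infimum is finite, since \<open>c * p y = p (c *\<^sub>R y)\<close> and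
    \<open>c *\<^sub>R y\<close> is the sum of \<open>x + c *\<^sub>R y\<close> and
    \<open>- x\<close>.\<close>
  have "- p (- x) \<le> p (x + c *\<^sub>R y) - c * p y" if "c \<in> F \<inter> {0..}" for c x
    using F_sublinear_add[OF p, of "x + c *\<^sub>R y" "- x"] F_sublinear_scale[OF p, of c y] that by simp
  then have bdd: "bdd_below ((\<lambda>c. p (x + c *\<^sub>R y) - c * p y) ` (F \<inter> {0..}))" for x
    by (intro bdd_belowI2) auto
  have low: "q x \<le> p (x + c *\<^sub>R y) - c * p y" if "c \<in> F" "0 \<le> c" for c x
    unfolding q_def by (rule cINF_lower[OF bdd]) (use that in auto)
  then show "c \<in> F \<Longrightarrow> 0 \<le> c \<Longrightarrow> q x \<le> p (x + c *\<^sub>R y) - c * p y" .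
  have great: "m \<le> q x" if "\<And>c. c \<in> F \<Longrightarrow> 0 \<le> c \<Longrightarrow> m \<le> p (x + c *\<^sub>R y) - c * p y" for m x
    unfolding q_def by (rule cINF_greatest[OF ne]) (use that in auto)
  show "F_sublinear F q"
  proof (rule F_sublinearI[OF F])
    fix x z
    \<comment> \<open>The parameter \<open>c + d\<close> for \<open>x + z\<close> is compared with
      independent parameters \<open>c\<close> for \<open>x\<close> and \<open>d\<close> for
      \<open>z\<close>.\<close>
    have *: "q (x + z) \<le> (p (x + c *\<^sub>R y) - c * p y) + (p (z + d *\<^sub>R y) - d * p y)"
      if "c \<in> F" "0 \<le> c" "d \<in> F" "0 \<le> d" for c d
      using low[of "c + d" "x + z"] F_sublinear_add[OF p, of "x + c *\<^sub>R y" "z + d *\<^sub>R y"] that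
      by (simp add: real_subfield_closed[OF F] algebra_simps)
    have "q (x + z) - (p (x + c *\<^sub>R y) - c * p y) \<le> q z" if "c \<in> F" "0 \<le> c" for c
      by (rule great) (use *[OF that] in \<open>simp add: algebra_simps\<close>)
    then have "q (x + z) - q z \<le> q x"
      by (intro great) (simp add: algebra_simps)
    then show "q (x + z) \<le> q x + q z" by simp
  next
    have "(\<lambda>c. p (0 + c *\<^sub>R y) - c * p y) ` (F \<inter> {0..}) = {0}"
      using ne F_sublinear_scale[OF p] by (auto simp: image_iff)
    then show "q 0 = 0" unfolding q_def by simp
  next
    fix k x assume k: "k \<in> F" "0 < k"
    \<comment> \<open>Parameter \<open>c\<close> at \<open>x\<close> corresponds to parameter
      \<open>k * c\<close> at \<open>k *\<^sub>R x\<close>.\<close>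
    have "q (k *\<^sub>R x) / k \<le> q x"
    proof (rule great)
      fix c assume c: "c \<in> F" "0 \<le> c"
      have "q (k *\<^sub>R x) \<le> p (k *\<^sub>R (x + c *\<^sub>R y)) - k * c * p y"
        using low[of "k * c" "k *\<^sub>R x"] c k
        by (simp add: real_subfield_closed[OF F] scaleR_right_distrib)
      then show "q (k *\<^sub>R x) / k \<le> p (x + c *\<^sub>R y) - c * p y"
        using F_sublinear_scale[OF p, of k "x + c *\<^sub>R y"] k by (simp add: field_simps)
    qed
    then show "q (k *\<^sub>R x) \<le> k * q x" using k by (simp add: field_simps)
  qed
qed

text \<open>The functional is a minimal element among the sublinear functions below \<open>\<psi>\<close>.\<close>

theorem F_Hahn_Banach:
  fixes \<psi> :: "'a::real_vector \<Rightarrow> real"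
  assumes F: "real_subfield F" and psi: "F_sublinear F \<psi>"
  obtains \<phi> where "\<phi> \<in> F_dual F" "\<And>x. \<phi> x \<le> \<psi> x"
proof -
  define A where "A = {p. F_sublinear F p \<and> p \<le> \<psi>}"
  \<comment> \<open>Zorn's lemma is applied to the reversed order, so its maximal element is a
    minimal one for the pointwise order.\<close>
  have "\<exists>m\<in>A. \<forall>a\<in>A. m \<ge> a \<longrightarrow> a = m"
  proof (rule predicate_Zorn)
    show "partial_order_on A (relation_of (\<ge>) A)"
      by (rule partial_order_on_relation_ofI) auto
    fix C assume "C \<in> Chains (relation_of (\<ge>) A)"
    then have C: "\<And>p q. p \<in> C \<Longrightarrow> q \<in> C \<Longrightarrow> p \<in> A \<and> q \<in> A \<and> (p \<le> q \<or> q \<le> p)"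
      unfolding Chains_def relation_of_def by blast
    show "\<exists>u\<in>A. \<forall>a\<in>C. u \<le> a"
    proof (cases "C = {}")
      \<comment> \<open>An infimum over the empty family would be meaningless, so \<psi> itself
        serves as the bound.\<close>
      case True
      then show ?thesis using psi by (auto simp: A_def)
    next
      case False
      have sub: "F_sublinear F p \<and> p \<le> \<psi>" if "p \<in> C" for p
        using C[OF that that] by (simp add: A_def)
      have chain: "p \<le> q \<or> q \<le> p" if "p \<in> C" "q \<in> C" for p q
        using C[OF that] by blast
      note inf = F_sublinear_chain_INF[OF F False sub chain]
      let ?u = "\<lambda>x. INF p\<in>C. p x"
      have below: "\<forall>p\<in>C. ?u \<le> p" using inf(2) by (auto simp: le_fun_def)
      obtain p where "p \<in> C" using False by blast
      with below sub have "?u \<le> \<psi>" by (meson order_trans)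
      with inf(1) below show ?thesis unfolding A_def by blast
    qed
  qed
  \<comment> \<open>Sublinear functions below \<open>p\<close> are also below \<psi>, so minimality
    in \<open>A\<close> is minimality among all of them.\<close>
  then obtain p where p: "F_sublinear F p" "p \<le> \<psi>"
    and min: "\<And>q. F_sublinear F q \<Longrightarrow> q \<le> p \<Longrightarrow> q = p"
    unfolding A_def by (metis (mono_tags, lifting) mem_Collect_eq order_trans)
  have add: "p (x + y) = p x + p y" for x y
  proof -
    define q where "q x = (INF c\<in>F \<inter> {0..}. p (x + c *\<^sub>R y) - c * p y)" for x
    have q: "F_sublinear F q" "\<And>c x. c \<in> F \<Longrightarrow> 0 \<le> c \<Longrightarrow> q x \<le> p (x + c *\<^sub>R y) - c * p y"
      using F_sublinear_shift[OF F p(1), where y = y] by (auto simp: q_def[abs_def])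
    have "q \<le> p" using q(2)[of 0] real_subfield_closed(1)[OF F] by (simp add: le_fun_def)
    with q(1) have "q = p" by (rule min)
    with q(2)[of 1 x] have "p x + p y \<le> p (x + y)"
      using real_subfield_closed(2)[OF F] by simp
    with F_sublinear_add[OF p(1)] show ?thesis by (simp add: antisym)
  qed
  have neg: "p (- x) = - p x" for x
    using add[of x "- x"] F_sublinear_zero[OF F p(1)] by simp
  have "p (c *\<^sub>R x) = c * p x" if "c \<in> F" for c x
  proof (cases "0 \<le> c")
    case False
    have "- c \<in> F" using real_subfield_closed(4)[OF F real_subfield_closed(1)[OF F] that] by simp
    with False F_sublinear_scale[OF p(1), of "- c" x] show ?thesis by (simp add: neg)
  qed (use F_sublinear_scale[OF p(1) that] in simp)
  with add have "p \<in> F_dual F" by (simp add: F_dual_def)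
  with p(2) show ?thesis by (intro that) (auto simp: le_fun_def)
qed

section \<open>Directional derivatives of convex functions over a subfield\<close>

text \<open>The case \<alpha> = 0 of \<open>strongly_convex\<close>, which is enough for existence
  and sublinearity of the derivatives.\<close>

definition F_convex_on :: "real set \<Rightarrow> 'a::real_vector set \<Rightarrow> ('a \<Rightarrow> real) \<Rightarrow> bool"
  where "F_convex_on F D f \<longleftrightarrow>
    (\<forall>x\<in>D. \<forall>y\<in>D. \<forall>t\<in>F \<inter> {0..1}.
      f (t *\<^sub>R x + (1 - t) *\<^sub>R y) \<le> t * f x + (1 - t) * f y)"

lemma F_convex_onD:
  assumes "F_convex_on F D f" "x \<in> D" "y \<in> D" "t \<in> F" "0 \<le> t" "t \<le> 1"
  shows "f (t *\<^sub>R x + (1 - t) *\<^sub>R y) \<le> t * f x + (1 - t) * f y"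
  using assms by (simp add: F_convex_on_def)

lemma algebraically_open_ray:
  assumes "algebraically_open F D" "x \<in> D"
  obtains e where "e > 0" "\<And>t. t \<in> F \<Longrightarrow> 0 < t \<Longrightarrow> t < e \<Longrightarrow> x + t *\<^sub>R h \<in> D"
proof -
  obtain e where e: "e > 0" "\<forall>t\<in>{0..e} \<inter> F. closed_segment x (x + t *\<^sub>R h) \<subseteq> D"
    using assms unfolding algebraically_open_def by blast
  show ?thesis
    by (rule that[OF e(1)]) (use e(2) in force)
qed

lemma eventually_ray_mem:
  assumes "algebraically_open F D" "x \<in> D"
  shows "\<forall>\<^sub>F t in at 0 within F \<inter> {0<..}. x + t *\<^sub>R h \<in> D"
  using algebraically_open_ray[OF assms, of h] eventually_at_0_within_pos by (metis (lifting))

lemma dir_derivI: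
  assumes "real_subfield F"
    and "((\<lambda>t. (f (x0 + t *\<^sub>R h) - f x0) / t) \<longlongrightarrow> l) (at 0 within F \<inter> {0<..})"
  shows "dir_deriv F f x0 h = l"
  unfolding dir_deriv_def by (rule tendsto_Lim[OF at_0_within_pos_neq_bot[OF assms(1)] assms(2)])

lemma tendsto_dir_deriv:
  assumes "real_subfield F" "dir_differentiable F f x0"
  shows "((\<lambda>t. (f (x0 + t *\<^sub>R h) - f x0) / t) \<longlongrightarrow> dir_deriv F f x0 h) (at 0 within F \<inter> {0<..})"
proof -
  obtain l where l: "((\<lambda>t. (f (x0 + t *\<^sub>R h) - f x0) / t) \<longlongrightarrow> l) (at 0 within F \<inter> {0<..})"
    using assms(2) unfolding dir_differentiable_def by blast
  with dir_derivI[OF assms(1) l] show ?thesis by simp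
qed

text \<open>The increment of \<open>f\<close> is \<open>t\<close> times a convergent difference
  quotient, hence tends to 0.\<close>

lemma tendsto_ray:
  assumes F: "real_subfield F" and diff: "dir_differentiable F f x0"
  shows "((\<lambda>t. f (x0 + t *\<^sub>R h)) \<longlongrightarrow> f x0) (at 0 within F \<inter> {0<..})"
proof -
  have "((\<lambda>t. f x0 + t * ((f (x0 + t *\<^sub>R h) - f x0) / t)) \<longlongrightarrow> f x0 + 0 * dir_deriv F f x0 h)
      (at 0 within F \<inter> {0<..})"
    by (intro tendsto_intros tendsto_dir_deriv[OF F diff])
  moreover have "\<forall>\<^sub>F t in at 0 within F \<inter> {0<..}.
      f x0 + t * ((f (x0 + t *\<^sub>R h) - f x0) / t) = f (x0 + t *\<^sub>R h)"
    by (rule eventually_at_0_within_pos[of 1]) auto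
  ultimately show ?thesis by (simp add: tendsto_cong)
qed

lemma F_convex_on_dir_differentiable:
  assumes F: "real_subfield F" and op: "algebraically_open F D"
    and conv: "F_convex_on F D f" and x0: "x0 \<in> D"
  shows "dir_differentiable F f x0"
  unfolding dir_differentiable_def
proof
  fix h
  let ?q = "\<lambda>h t. (f (x0 + t *\<^sub>R h) - f x0) / t"
  \<comment> \<open>The point \<open>x0 + s *\<^sub>R k\<close> is the convex combination of
    \<open>x0 + t *\<^sub>R k\<close> and \<open>x0\<close> with weight \<open>s / t\<close>, which
    lies in \<open>F\<close>. The direction \<open>k\<close> is kept general because both
    \<open>h\<close> and \<open>- h\<close> are used.\<close>
  have mono: "?q k s \<le> ?q k t"
    if "s \<in> F" "t \<in> F" "0 < s" "s < t" "x0 + t *\<^sub>R k \<in> D" for k s t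
  proof -
    have "s / t \<in> F" using that by (intro real_subfield_closed[OF F])
    moreover have "(s / t) *\<^sub>R (x0 + t *\<^sub>R k) + (1 - s / t) *\<^sub>R x0 = x0 + s *\<^sub>R k"
      using that by (simp add: algebra_simps)
    ultimately have "f (x0 + s *\<^sub>R k) \<le> s / t * f (x0 + t *\<^sub>R k) + (1 - s / t) * f x0"
      using F_convex_onD[OF conv, of "x0 + t *\<^sub>R k" x0 "s / t"] that x0 by simp
    then have "f (x0 + s *\<^sub>R k) - f x0 \<le> s * ?q k t"
      by (simp add: algebra_simps diff_divide_distrib)
    with that show ?thesis by (simp add: field_simps)
  qed
  have half: "1 / 2 \<in> F"
    using real_subfield_closed(2,3,6)[OF F] by (metis one_add_one)
  obtain e where e: "e > 0" "\<And>t. t \<in> F \<Longrightarrow> 0 < t \<Longrightarrow> t < e \<Longrightarrow> x0 + t *\<^sub>R h \<in> D"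
    using algebraically_open_ray[OF op x0] by blast
  obtain e' where e': "e' > 0" "\<And>t. t \<in> F \<Longrightarrow> 0 < t \<Longrightarrow> t < e' \<Longrightarrow> x0 + t *\<^sub>R (- h) \<in> D"
    using algebraically_open_ray[OF op x0] by blast
  obtain d where d: "d \<in> F" "0 < d" "d < min e e'"
    using real_subfield_small_pos[OF F] e(1) e'(1) by (metis min_less_iff_conj)
  \<comment> \<open>As \<open>x0\<close> is the midpoint of \<open>x0 + t *\<^sub>R h\<close> and
    \<open>x0 - t *\<^sub>R h\<close>, the forward quotient is at least minus the backward one;
    monotonicity then replaces \<open>t\<close> by the fixed \<open>d\<close>.\<close>
  have lower: "- ?q (- h) d \<le> ?q h t" if t: "t \<in> F" "0 < t" "t < d" for t
  proof -
    have "(1 / 2) *\<^sub>R (x0 + t *\<^sub>R h) + (1 - 1 / 2) *\<^sub>R (x0 + t *\<^sub>R (- h)) = x0"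
      by (simp add: algebra_simps flip: scaleR_add_left)
    then have "f x0 \<le> 1 / 2 * f (x0 + t *\<^sub>R h) + (1 - 1 / 2) * f (x0 + t *\<^sub>R (- h))"
      using F_convex_onD[OF conv, of "x0 + t *\<^sub>R h" "x0 + t *\<^sub>R (- h)" "1 / 2"] half e e' t d by simp
    then have "- (f (x0 + t *\<^sub>R (- h)) - f x0) / t \<le> ?q h t"
      using t by (intro divide_right_mono) auto
    moreover have "?q (- h) t \<le> ?q (- h) d" using d t e'(2) by (intro mono) auto
    ultimately show ?thesis by (simp only: minus_divide_left)
  qed
  have incr: "?q h s \<le> ?q h t" if "s \<in> F" "t \<in> F" "0 < s" "s < t" "t < d" for s t
    using that d e(2) by (intro mono) auto
  obtain l where "(?q h \<longlongrightarrow> l) (at 0 within F \<inter> {0<..})"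
    using mono_bounded_tendsto_at_0_within_pos[where q = "?q h", OF F \<open>0 < d\<close> incr lower] by blast
  then show "\<exists>l. (?q h \<longlongrightarrow> l) (at 0 within F \<inter> {0<..})" ..
qed

text \<open>Subadditivity comes from midpoint convexity: \<open>x0 + t *\<^sub>R (h + k)\<close> is
  the midpoint of the points reached along \<open>2 *\<^sub>R h\<close> and
  \<open>2 *\<^sub>R k\<close>. Homogeneity then cancels the factor 2.\<close>

lemma F_convex_on_dir_deriv_sublinear:
  assumes F: "real_subfield F" and op: "algebraically_open F D"
    and conv: "F_convex_on F D f" and x0: "x0 \<in> D"
  shows "F_sublinear F (dir_deriv F f x0)"
proof -
  note lim = tendsto_dir_deriv[OF F F_convex_on_dir_differentiable[OF assms]]
  have scale: "dir_deriv F f x0 (c *\<^sub>R h) = c * dir_deriv F f x0 h" if c: "c \<in> F" "0 < c" for c h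
  proof (rule dir_derivI[OF F])
    have "((\<lambda>t. c * ((f (x0 + (c * t) *\<^sub>R h) - f x0) / (c * t))) \<longlongrightarrow> c * dir_deriv F f x0 h)
        (at 0 within F \<inter> {0<..})"
      by (intro tendsto_mult_left filterlim_compose[OF lim filterlim_mult_at_0_within_pos[OF F c]])
    then show "((\<lambda>t. (f (x0 + t *\<^sub>R c *\<^sub>R h) - f x0) / t) \<longlongrightarrow> c * dir_deriv F f x0 h)
        (at 0 within F \<inter> {0<..})"
      using c by (simp add: mult.commute)
  qed
  have two: "2 \<in> F" and half: "1 / 2 \<in> F"
    using real_subfield_closed(2,3,6)[OF F] by (metis one_add_one)+
  show ?thesis
  proof (rule F_sublinearI[OF F])
    fix h k
    have "dir_deriv F f x0 (h + k)
        \<le> 1 / 2 * dir_deriv F f x0 (2 *\<^sub>R h) + 1 / 2 * dir_deriv F f x0 (2 *\<^sub>R k)"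
    proof (rule tendsto_le[OF at_0_within_pos_neq_bot[OF F] _ lim])
      show "((\<lambda>t. 1 / 2 * ((f (x0 + t *\<^sub>R 2 *\<^sub>R h) - f x0) / t)
            + 1 / 2 * ((f (x0 + t *\<^sub>R 2 *\<^sub>R k) - f x0) / t))
          \<longlongrightarrow> 1 / 2 * dir_deriv F f x0 (2 *\<^sub>R h) + 1 / 2 * dir_deriv F f x0 (2 *\<^sub>R k))
          (at 0 within F \<inter> {0<..})"
        by (intro tendsto_add tendsto_mult_left lim)
      have pos: "\<forall>\<^sub>F t in at 0 within F \<inter> {0<..}. 0 < t"
        by (rule eventually_at_0_within_pos[of 1]) auto
      show "\<forall>\<^sub>F t in at 0 within F \<inter> {0<..}. (f (x0 + t *\<^sub>R (h + k)) - f x0) / t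
          \<le> 1 / 2 * ((f (x0 + t *\<^sub>R 2 *\<^sub>R h) - f x0) / t)
            + 1 / 2 * ((f (x0 + t *\<^sub>R 2 *\<^sub>R k) - f x0) / t)"
        using eventually_ray_mem[OF op x0, of "2 *\<^sub>R h"] eventually_ray_mem[OF op x0, of "2 *\<^sub>R k"] pos
      proof eventually_elim
        case (elim t)
        have "(1 / 2) *\<^sub>R (x0 + t *\<^sub>R 2 *\<^sub>R h) + (1 - 1 / 2) *\<^sub>R (x0 + t *\<^sub>R 2 *\<^sub>R k)
            = x0 + t *\<^sub>R (h + k)"
          by (simp add: algebra_simps flip: scaleR_add_left)
        then have "f (x0 + t *\<^sub>R (h + k))
            \<le> 1 / 2 * f (x0 + t *\<^sub>R 2 *\<^sub>R h) + (1 - 1 / 2) * f (x0 + t *\<^sub>R 2 *\<^sub>R k)"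
          using F_convex_onD[OF conv elim(1,2) half] by simp
        with elim(3) show ?case by (simp add: field_simps)
      qed
    qed
    then show "dir_deriv F f x0 (h + k) \<le> dir_deriv F f x0 h + dir_deriv F f x0 k"
      using scale[OF two] by simp
  next
    show "dir_deriv F f x0 0 = 0" by (rule dir_derivI[OF F]) simp
  qed (simp add: scale)
qed

section \<open>Strong convexity\<close>

text \<open>The arguments of \<alpha> are \<open>x - ?z\<close> and \<open>y - ?z\<close> with
  \<open>?z\<close> in \<open>D\<close> by convexity, so both subtracted terms are
  nonnegative.\<close>

lemma strongly_convex_imp_F_convex_on:
  assumes conv: "convex D" and nonneg: "\<forall>u\<in>diff_set D. 0 \<le> \<alpha> u"
    and f: "strongly_convex \<alpha> F D f"
  shows "F_convex_on F D f"
  unfolding F_convex_on_def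
proof (intro ballI)
  fix x y t assume xyt: "x \<in> D" "y \<in> D" "t \<in> F \<inter> {0..1}"
  let ?z = "t *\<^sub>R x + (1 - t) *\<^sub>R y"
  have z: "?z \<in> D" using conv xyt by (intro convexD) auto
  have "(1 - t) *\<^sub>R (x - y) = x - ?z" "t *\<^sub>R (y - x) = y - ?z"
    by (simp_all add: algebra_simps)
  with z xyt have "(1 - t) *\<^sub>R (x - y) \<in> diff_set D" "t *\<^sub>R (y - x) \<in> diff_set D"
    unfolding diff_set_def by blast+
  with nonneg xyt have "0 \<le> t * \<alpha> ((1 - t) *\<^sub>R (x - y))" "0 \<le> (1 - t) * \<alpha> (t *\<^sub>R (y - x))"
    by simp_all
  moreover have "f ?z \<le> t * f x + (1 - t) * f y
      - t * \<alpha> ((1 - t) *\<^sub>R (x - y)) - (1 - t) * \<alpha> (t *\<^sub>R (y - x))"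
    using f xyt unfolding strongly_convex_def by blast
  ultimately show "f ?z \<le> t * f x + (1 - t) * f y" by linarith
qed

lemma strongly_convex_dir_deriv_support:
  assumes F: "real_subfield F" and op: "algebraically_open F D" and conv: "convex D"
    and nonneg: "\<forall>u\<in>diff_set D. 0 \<le> \<alpha> u"
    and f: "strongly_convex \<alpha> F D f" and D: "x0 \<in> D" "x \<in> D"
  shows "f x0 + dir_deriv F f x0 (x - x0) + \<alpha> (x - x0) \<le> f x"
proof -
  define u where "u = x - x0"
  note fc = strongly_convex_imp_F_convex_on[OF conv nonneg f]
  note diff = F_convex_on_dir_differentiable[OF F op fc]
  \<comment> \<open>The factor \<open>1 + 0\<close> is the limit of the factor \<open>1 + s\<close>
    below.\<close>
  have "(1 + 0) * dir_deriv F f x0 u \<le> f x - f x0 - \<alpha> u"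
  proof (rule tendsto_le[OF at_0_within_pos_neq_bot[OF F]])
    show "((\<lambda>s. f (x + s *\<^sub>R u) - f x0 - \<alpha> u) \<longlongrightarrow> f x - f x0 - \<alpha> u) (at 0 within F \<inter> {0<..})"
      by (intro tendsto_intros tendsto_ray[OF F diff[OF D(2)]])
    show "((\<lambda>s. (1 + s) * ((f (x0 + s *\<^sub>R u) - f x0) / s)) \<longlongrightarrow> (1 + 0) * dir_deriv F f x0 u)
        (at 0 within F \<inter> {0<..})"
      by (intro tendsto_intros tendsto_dir_deriv[OF F diff[OF D(1)]])
    have pos: "\<forall>\<^sub>F s in at 0 within F \<inter> {0<..}. s \<in> F \<and> 0 < s"
      by (rule eventually_at_0_within_pos[of 1]) auto
    show "\<forall>\<^sub>F s in at 0 within F \<inter> {0<..}.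
        (1 + s) * ((f (x0 + s *\<^sub>R u) - f x0) / s) \<le> f (x + s *\<^sub>R u) - f x0 - \<alpha> u"
      using eventually_ray_mem[OF op D(1), of u] eventually_ray_mem[OF op D(2), of u] pos
    proof eventually_elim
      case (elim s)
      \<comment> \<open>This choice gives \<open>(1 - t) * (1 + s) = 1\<close>, which turns the
        first argument of \<alpha> into exactly \<open>u\<close>, and
        \<open>t * (1 + s) = s\<close>.\<close>
      define t where "t = s / (1 + s)"
      have s: "s \<in> F" "0 < s" using elim by auto
      have t: "t \<in> F \<inter> {0..1}"
        using s by (auto simp: t_def real_subfield_closed[OF F])
      have t1: "1 - t = 1 / (1 + s)" using s by (simp add: t_def field_simps)
      have xu: "x + s *\<^sub>R u - x0 = (1 + s) *\<^sub>R u" by (simp add: u_def algebra_simps)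
      have 1: "(1 - t) *\<^sub>R (x + s *\<^sub>R u - x0) = u"
        unfolding xu t1 using s by simp
      have 2: "t *\<^sub>R (x0 - (x + s *\<^sub>R u)) = x0 - (x0 + s *\<^sub>R u)"
      proof -
        have "t *\<^sub>R (x0 - (x + s *\<^sub>R u)) = - (t *\<^sub>R (x + s *\<^sub>R u - x0))"
          by (simp add: algebra_simps)
        also have "\<dots> = x0 - (x0 + s *\<^sub>R u)" unfolding xu using s by (simp add: t_def)
        finally show ?thesis .
      qed
      have 3: "t *\<^sub>R (x + s *\<^sub>R u) + (1 - t) *\<^sub>R x0 = x0 + s *\<^sub>R u"
        using 2 by (simp add: algebra_simps)
      have "x0 - (x0 + s *\<^sub>R u) \<in> diff_set D" using elim D unfolding diff_set_def by blast
      with nonneg t have "0 \<le> (1 - t) * \<alpha> (x0 - (x0 + s *\<^sub>R u))" by simp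
      moreover have "f (x0 + s *\<^sub>R u) \<le> t * f (x + s *\<^sub>R u) + (1 - t) * f x0 - t * \<alpha> u
          - (1 - t) * \<alpha> (x0 - (x0 + s *\<^sub>R u))"
        using f[unfolded strongly_convex_def, rule_format, OF elim(2) D(1) t] unfolding 1 2 3 .
      ultimately have "f (x0 + s *\<^sub>R u) - f x0 \<le> t * (f (x + s *\<^sub>R u) - f x0 - \<alpha> u)"
        by (simp add: algebra_simps)
      \<comment> \<open>Multiplying by \<open>1 + s\<close> turns the weight \<open>t\<close> into
        \<open>s\<close>; division by \<open>s\<close> then produces the difference
        quotient.\<close>
      then have "(1 + s) * (f (x0 + s *\<^sub>R u) - f x0)
          \<le> (1 + s) * (t * (f (x + s *\<^sub>R u) - f x0 - \<alpha> u))"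
        using s by (intro mult_left_mono) auto
      also have "\<dots> = s * (f (x + s *\<^sub>R u) - f x0 - \<alpha> u)"
        using s by (simp add: t_def)
      finally show ?case using s by (simp add: pos_divide_le_eq mult.commute)
    qed
  qed
  then show ?thesis by (simp add: u_def)
qed

lemma strongly_convexI_support:
  assumes F: "real_subfield F" and conv: "convex D"
    and supp: "\<And>x0. x0 \<in> D \<Longrightarrow> \<exists>\<phi>\<in>F_dual F. \<forall>x\<in>D. f x0 + \<phi> (x - x0) + \<alpha> (x - x0) \<le> f x"
  shows "strongly_convex \<alpha> F D f"
  unfolding strongly_convex_def
proof (intro ballI)
  fix x y t assume xyt: "x \<in> D" "y \<in> D" "t \<in> F \<inter> {0..1}"
  let ?z = "t *\<^sub>R x + (1 - t) *\<^sub>R y"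
  have "?z \<in> D" using conv xyt by (intro convexD) auto
  then obtain \<phi> where phi: "\<phi> \<in> F_dual F" "\<forall>x\<in>D. f ?z + \<phi> (x - ?z) + \<alpha> (x - ?z) \<le> f x"
    using supp by blast
  have x: "x - ?z = (1 - t) *\<^sub>R (x - y)" and y: "y - ?z = t *\<^sub>R (y - x)"
    by (simp_all add: algebra_simps)
  have t: "t \<in> F" "1 - t \<in> F" using xyt by (auto simp: real_subfield_closed[OF F])
  \<comment> \<open>The linear terms cancel in the average: both weights lie in \<open>F\<close>,
    and the weighted displacements from \<open>?z\<close> sum to 0.\<close>
  have "t * \<phi> (x - ?z) + (1 - t) * \<phi> (y - ?z) = \<phi> (t *\<^sub>R (x - ?z) + (1 - t) *\<^sub>R (y - ?z))"
    using phi(1) t by (simp add: F_dual_def)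
  \<comment> \<open>Zero is written as \<open>0 *\<^sub>R 0\<close> so that homogeneity with the
    scalar 0 evaluates \<phi> there.\<close>
  also have "t *\<^sub>R (x - ?z) + (1 - t) *\<^sub>R (y - ?z) = 0 *\<^sub>R 0"
    unfolding x y by (simp add: algebra_simps)
  also have "\<phi> (0 *\<^sub>R 0) = 0"
    using phi(1) real_subfield_closed(1)[OF F] unfolding F_dual_def by fastforce
  finally have zero: "t * \<phi> (x - ?z) + (1 - t) * \<phi> (y - ?z) = 0" .
  have "t * (f ?z + \<phi> (x - ?z) + \<alpha> (x - ?z)) + (1 - t) * (f ?z + \<phi> (y - ?z) + \<alpha> (y - ?z))
      \<le> t * f x + (1 - t) * f y"
    using phi(2) xyt by (intro add_mono mult_left_mono) auto
  moreover have "t * (f ?z + \<phi> (x - ?z) + \<alpha> (x - ?z)) + (1 - t) * (f ?z + \<phi> (y - ?z) + \<alpha> (y - ?z))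
      = f ?z + (t * \<phi> (x - ?z) + (1 - t) * \<phi> (y - ?z)) + t * \<alpha> (x - ?z) + (1 - t) * \<alpha> (y - ?z)"
    by (simp only: ring_distribs)
  ultimately have "f ?z \<le> t * f x + (1 - t) * f y - t * \<alpha> (x - ?z) - (1 - t) * \<alpha> (y - ?z)"
    using zero by linarith
  then show "f ?z \<le> t * f x + (1 - t) * f y
      - t * \<alpha> ((1 - t) *\<^sub>R (x - y)) - (1 - t) * \<alpha> (t *\<^sub>R (y - x))"
    unfolding x y .
qed

section \<open>The equivalence, by the cycle (i) to (ii) to (iii) to (i)\<close>

theorem theorem8:
  fixes F :: "real set"
    and D :: "'a::real_vector set"
    and \<alpha> :: "'a \<Rightarrow> real"
    and f :: "'a \<Rightarrow> real"
  assumes "real_subfield F"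
    and "D \<noteq> {}"
    and "algebraically_open F D"
    and "convex D"
    and "\<forall>u\<in>diff_set D. 0 \<le> \<alpha> u"
    and "\<forall>u\<in>diff_set D. \<alpha> (- u) = \<alpha> u"
  shows "(strongly_convex \<alpha> F D f \<longleftrightarrow>
            (\<forall>x0\<in>D. dir_differentiable F f x0) \<and>
            (\<forall>x0\<in>D. F_sublinear F (dir_deriv F f x0)) \<and>
            (\<forall>x0\<in>D. \<forall>x\<in>D. f x \<ge> f x0 + dir_deriv F f x0 (x - x0) + \<alpha> (x - x0))) \<and>
         (strongly_convex \<alpha> F D f \<longleftrightarrow>
            (\<forall>x0\<in>D. \<exists>\<phi>\<in>F_dual F. \<forall>x\<in>D. f x \<ge> f x0 + \<phi> (x - x0) + \<alpha> (x - x0)))"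
proof -
  note F = assms(1)
  let ?ii = "(\<forall>x0\<in>D. dir_differentiable F f x0) \<and>
    (\<forall>x0\<in>D. F_sublinear F (dir_deriv F f x0)) \<and>
    (\<forall>x0\<in>D. \<forall>x\<in>D. f x \<ge> f x0 + dir_deriv F f x0 (x - x0) + \<alpha> (x - x0))"
  let ?iii = "\<forall>x0\<in>D. \<exists>\<phi>\<in>F_dual F. \<forall>x\<in>D. f x \<ge> f x0 + \<phi> (x - x0) + \<alpha> (x - x0)"
  have ii: ?ii if f: "strongly_convex \<alpha> F D f"
  proof -
    note fc = strongly_convex_imp_F_convex_on[OF assms(4,5) f]
    show ?thesis
      using F_convex_on_dir_differentiable[OF F assms(3) fc]
        F_convex_on_dir_deriv_sublinear[OF F assms(3) fc]
        strongly_convex_dir_deriv_support[OF F assms(3-5) f] by blast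
  qed
  have iii: ?iii if ii: ?ii
  proof
    fix x0 assume x0: "x0 \<in> D"
    with ii have "F_sublinear F (dir_deriv F f x0)" by blast
    from F_Hahn_Banach[OF F this]
    obtain \<phi> where phi: "\<phi> \<in> F_dual F" "\<And>h. \<phi> h \<le> dir_deriv F f x0 h" by blast
    have "f x0 + \<phi> (x - x0) + \<alpha> (x - x0) \<le> f x" if "x \<in> D" for x
    proof -
      have "f x0 + dir_deriv F f x0 (x - x0) + \<alpha> (x - x0) \<le> f x" using ii x0 that by blast
      with phi(2)[of "x - x0"] show ?thesis by linarith
    qed
    with phi(1) show "\<exists>\<phi>\<in>F_dual F. \<forall>x\<in>D. f x \<ge> f x0 + \<phi> (x - x0) + \<alpha> (x - x0)" by blast
  qed
  have i: "strongly_convex \<alpha> F D f" if ?iii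
    using strongly_convexI_support[OF F assms(4)] that by blast
  from ii iii i show ?thesis by argo
qed

end
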